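(* Let $X$ be a transitive real Banach space and let $Y\subset X$ be a subspace with $\mathrm{dens}(Y)\leq 2^{\aleph_0}$. Then there exists a closed subspace $Z\subset X$ such that (1) $Y\subset Z$; (2) $\mathrm{dens}(Z)\leq 2^{\aleph_0}$; (3) $Z$ is transitive with respect to the subgroup $\mathcal{T}=\{T\in\mathcal{G}_X : T(Z)=Z\}$ of $\mathcal{G}_X$, i.e. for all $x,y\in\mathbf{S}_Z$ there is $T\in\mathcal{T}$ with $T(x)=y$.
   Context: All Banach spaces are real. For a Banach space $E$, let $\mathbf{S}_E$ be its unit sphere and $\mathcal{G}_E$ the group of isometric automorphisms (surjective linear isometries) $T\colon E\to E$. The space $E$ is called transitive if for every $x\in\mathbf{S}_E$ one has $\{T(x): T\in\mathcal{G}_E\}=\mathbf{S}_E$. The density character $\mathrm{dens}(E)$ is the smallest cardinal $\kappa$ such that $E$ contains a dense subset of cardinality $\kappa$. *)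

theory Defs
  imports "HOL-Analysis.Analysis"
begin

unbundle cardinal_syntax

text \<open>
  Subspaces of \<open>X\<close> are represented as subsets of the type, so the density character is
  defined for subsets: the cardinal of a dense subset of \<open>S\<close> of least cardinality. A cardinal is a
  cardinal order and thus only meaningful up to \<open>=o\<close>. The minimum used in the definition exists by
  \<open>dens_attained\<close>.
\<close>

definition dense_subset :: "'a::topological_space set \<Rightarrow> 'a set \<Rightarrow> bool" where
  "dense_subset D S \<longleftrightarrow> D \<subseteq> S \<and> S \<subseteq> closure D"

definition dens :: "'a::topological_space set \<Rightarrow> 'a rel" where
  "dens S = |SOME D. dense_subset D S \<and> (\<forall>D'. dense_subset D' S \<longrightarrow> |D| \<le>o |D'| )|"

lemma dens_attained:
  obtains D where "dense_subset D S" "dens S = |D|"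
    "\<And>D'. dense_subset D' S \<Longrightarrow> |D| \<le>o |D'|"
proof -
  let ?R = "{|D| | D. dense_subset D S}"
  have "dense_subset S S"
    by (simp add: dense_subset_def closure_subset)
  then have "?R \<noteq> {}" by blast
  moreover have "\<forall>r\<in>?R. Card_order r"
    by (auto intro: card_of_Card_order)
  ultimately obtain r where "r \<in> ?R" "\<forall>r'\<in>?R. r \<le>o r'"
    using exists_minim_Card_order[of ?R] by blast
  then have "\<exists>D. dense_subset D S \<and> (\<forall>D'. dense_subset D' S \<longrightarrow> |D| \<le>o |D'| )"
    by blast
  from someI_ex[OF this] show thesis
    using that unfolding dens_def by blast
qed

definition unit_sphere :: "'a::real_normed_vector set \<Rightarrow> 'a set" where
  "unit_sphere E = {x \<in> E. norm x = 1}"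

definition isometry_group :: "('a::real_normed_vector \<Rightarrow> 'a) set" where
  "isometry_group = {T. linear T \<and> surj T \<and> (\<forall>x. norm (T x) = norm x)}"

definition transitive_space :: "'a::real_normed_vector itself \<Rightarrow> bool" where
  "transitive_space _ \<longleftrightarrow>
     (\<forall>x \<in> unit_sphere (UNIV :: 'a set). {T x | T. T \<in> isometry_group} = unit_sphere UNIV)"

end

theory Submission
  imports Defs
begin

text \<open>
  Fix, for every pair of unit vectors \<open>x\<close>, \<open>y\<close>, one isometric automorphism that sends \<open>x\<close> to
  \<open>y\<close>, and take for \<open>Z\<close> the closure of a small dense subset \<open>D\<close> of \<open>Y\<close> under the following
  operations: the combinations \<open>x + r y\<close> with \<open>r\<close> real, applying the isometry chosen for a pair,
  applying its inverse, and taking limits of convergent sequences. Closure under these makes \<open>Z\<close> a closed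
  subspace that contains \<open>Y\<close> and that every isometry chosen for a pair of unit vectors of \<open>Z\<close>
  maps onto itself.

  What needs an argument is that \<open>Z\<close> is small. Every operation takes at most countably many
  arguments and there are at most continuum many operations, so an element of \<open>Z\<close> is described by
  a well-founded, countably branching tree with labels in a set \<open>L\<close> of size at most
  \<open>2\<^sup>\<aleph>\<^sub>0\<close>. Instead of building \<open>Z\<close> in \<open>\<omega>\<^sub>1\<close> stages, the proof reads such a tree as a function
  from the countable set of its possible nodes, which are finite sequences of naturals, to \<open>L\<close>.
  There are at most \<open>(2\<^sup>\<aleph>\<^sub>0)\<^sup>\<aleph>\<^sub>0 = 2\<^sup>\<aleph>\<^sub>0\<close> of these
  (\<open>closure_under_operations_le_continuum\<close>). So \<open>Z\<close> itself, and not only a dense subset of it, has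
  at most continuum many elements.
\<close>

section \<open>Closing a set under operations of countable arity\<close>

text \<open>
  A description of an element is a labelled tree: a leaf carries a generator from \<open>A\<close>, an inner
  node an operation from \<open>F\<close> and one subtree for each natural number. The node reached by the path
  \<open>p\<close> has the label \<open>c p\<close>. A leaf repeats its label on all longer paths, which makes the tree of a
  leaf a total function; the root label alone separates leaves from inner nodes.
\<close>

inductive describes ::
  "'a set \<Rightarrow> ((nat \<Rightarrow> 'a) \<Rightarrow> 'a) set \<Rightarrow> (nat list \<Rightarrow> 'a + ((nat \<Rightarrow> 'a) \<Rightarrow> 'a)) \<Rightarrow> 'a \<Rightarrow> bool"
  for A F where
    generator: "a \<in> A \<Longrightarrow> describes A F (\<lambda>_. Inl a) a"
  | operation: "f \<in> F \<Longrightarrow> (\<And>n. describes A F (c n) (s n)) \<Longrightarrow>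
      describes A F (\<lambda>p. case p of [] \<Rightarrow> Inr f | n # q \<Rightarrow> c n q) (f s)"

text \<open>
  The root label tells which rule was used, and with an operation at the root the subtrees can be
  read off the tree, so evaluation from the leaves upwards is determined.
\<close>

lemma describes_unique:
  assumes "describes A F c x" and "describes A F c y"
  shows "x = y"
  using assms
proof (induction arbitrary: y rule: describes.induct)
  case (generator a)
  from generator(2) show ?case
  proof cases
    case generator
    then show ?thesis by (metis Inl_inject)
  next
    case (operation f c s)
    from fun_cong[OF operation(1), of "[]"] show ?thesis by simp
  qed
next
  case (operation f c s)
  from operation(4) show ?case
  proof cases
    case generator
    from fun_cong[OF generator(1), of "[]"] show ?thesis by simp
  next
    case op': (operation f' c' s')
    from fun_cong[OF op'(1), of "[]"] have "f' = f" by simp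
    moreover have "c' n = c n" for n
    proof
      fix q
      from fun_cong[OF op'(1), of "n # q"] show "c' n q = c n q" by simp
    qed
    then have "s' = s" using operation.IH op'(4) by (metis ext)
    ultimately show ?thesis using op'(2) by simp
  qed
qed

lemma describes_labels:
  assumes "describes A F c x"
  shows "c p \<in> A <+> F"
  using assms
proof (induction arbitrary: p rule: describes.induct)
  case (generator a)
  then show ?case by (rule InlI)
next
  case (operation f c s)
  then show ?case by (cases p) auto
qed

text \<open>
  The exponent is at most \<open>\<aleph>\<^sub>0\<close>, and raising \<open>2\<^sup>\<aleph>\<^sub>0\<close> to the power \<open>\<aleph>\<^sub>0\<close> only replaces the
  exponent \<open>\<aleph>\<^sub>0\<close> of 2 by \<open>\<aleph>\<^sub>0 \<cdot> \<aleph>\<^sub>0 = \<aleph>\<^sub>0\<close>.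
\<close>

lemma card_Func_countable_le_continuum:
  fixes B :: "'b set"
  assumes "|B| \<le>o ctwo ^c natLeq"
  shows "|Func (UNIV :: 'i::countable set) B| \<le>o ctwo ^c natLeq"
proof -
  have "|UNIV :: 'i set| \<le>o |UNIV :: nat set|"
    by (rule card_of_ordLeqI[OF inj_to_nat]) simp
  from ordLeq_ordIso_trans[OF this card_of_nat] have i: "|UNIV :: 'i set| \<le>o natLeq" .
  have "|Func (UNIV :: 'i set) B| = |B| ^c |UNIV :: 'i set|"
    by (simp only: cexp_def Field_card_of)
  also have "|B| ^c |UNIV :: 'i set| \<le>o (ctwo ^c natLeq) ^c |UNIV :: 'i set|"
    by (rule cexp_mono1[OF assms card_of_Card_order])
  also have "(ctwo ^c natLeq) ^c |UNIV :: 'i set| \<le>o (ctwo ^c natLeq) ^c natLeq"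
    by (rule cexp_mono2'[OF i Card_order_cexp]) (simp add: Field_card_of)
  also have "(ctwo ^c natLeq) ^c natLeq =o ctwo ^c (natLeq *c natLeq)"
    by (rule cexp_cprod[OF Card_order_ctwo])
  also have "ctwo ^c (natLeq *c natLeq) =o ctwo ^c natLeq"
    by (rule cexp_cong2[OF cprod_infinite[OF natLeq_Cinfinite] Card_order_ctwo Card_order_cprod])
  finally show ?thesis .
qed

lemma Cinfinite_continuum: "Cinfinite (ctwo ^c natLeq)"
  by (rule Cinfinite_cexp[OF _ natLeq_Cinfinite]) (simp add: Card_order_ctwo ordLeq_refl)

lemma finite_le_continuum: "finite A \<Longrightarrow> |A| \<le>o ctwo ^c natLeq"
  by (rule ordLess_imp_ordLeq[OF ordLess_ordLeq_trans[OF _ natLeq_ordLeq_cinfinite[OF Cinfinite_continuum]]])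
    (simp add: finite_iff_ordLess_natLeq)

lemma Un_le_continuum:
  assumes "|A| \<le>o ctwo ^c natLeq" and "|B| \<le>o ctwo ^c natLeq"
  shows "|A \<union> B| \<le>o ctwo ^c natLeq"
  by (rule Un_Cinfinite_bound[OF assms Cinfinite_continuum])

text \<open>
  The set \<open>Z\<close> of all described elements contains the generators and is closed because countably
  many trees can be joined at a new root. It is small because a tree describes only one element.
\<close>

lemma closure_under_operations_le_continuum:
  fixes A :: "'a set" and F :: "((nat \<Rightarrow> 'a) \<Rightarrow> 'a) set"
  assumes A: "|A| \<le>o ctwo ^c natLeq" and F: "|F| \<le>o ctwo ^c natLeq"
  obtains Z where "A \<subseteq> Z" and "\<And>f s. f \<in> F \<Longrightarrow> range s \<subseteq> Z \<Longrightarrow> f s \<in> Z"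
    and "|Z| \<le>o ctwo ^c natLeq"
proof -
  define Z where "Z = {x. \<exists>c. describes A F c x}"
  have described: "x \<in> Z" if "describes A F c x" for c x
    unfolding Z_def mem_Collect_eq by (rule exI) (rule that)
  have generators: "A \<subseteq> Z"
    by (rule subsetI) (rule described[OF describes.generator])
  have operations: "f s \<in> Z" if "f \<in> F" "range s \<subseteq> Z" for f s
  proof -
    from that(2) have "\<forall>n. \<exists>c. describes A F c (s n)"
      by (auto simp: Z_def)
    then have "\<exists>c. \<forall>n. describes A F (c n) (s n)" by (rule choice)
    then obtain c where "\<And>n. describes A F (c n) (s n)" by blast
    from describes.operation[OF that(1) this] show ?thesis
      by (rule described)
  qed
  define code where "code x = (SOME c. describes A F c x)" for x
  have code: "describes A F (code x) x" if "x \<in> Z" for x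
    using that unfolding Z_def code_def mem_Collect_eq by (rule someI_ex)
  have "inj_on code Z"
  proof (rule inj_onI)
    fix x y
    assume "x \<in> Z" "y \<in> Z" "code x = code y"
    with code[of x] code[of y] have "describes A F (code y) x" "describes A F (code y) y"
      by simp_all
    then show "x = y" by (rule describes_unique)
  qed
  moreover have "code x \<in> Func UNIV (A <+> F)" if "x \<in> Z" for x
    using describes_labels[OF code[OF that]] by (simp add: Func_def)
  ultimately have "|Z| \<le>o |Func (UNIV :: nat list set) (A <+> F)|"
    by (rule card_of_ordLeqI)
  moreover have "|A <+> F| \<le>o ctwo ^c natLeq"
    using card_of_Plus_ordLeq_infinite_Field[OF _ A F] Cinfinite_continuum
    by (simp add: cinfinite_def)
  ultimately have "|Z| \<le>o ctwo ^c natLeq"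
    by (rule ordLeq_transitive[OF _ card_Func_countable_le_continuum])
  with generators operations show thesis by (rule that)
qed

section \<open>The invariant subspace\<close>

text \<open>A real number is determined by its lower Dedekind cut of rationals.\<close>

lemma card_real_le_continuum: "|UNIV :: real set| \<le>o ctwo ^c natLeq"
proof -
  define cut where "cut r = (\<lambda>q::rat. real_of_rat q < r)" for r :: real
  have "inj cut"
  proof (rule injI, rule ccontr)
    fix x y :: real
    assume eq: "cut x = cut y" and "x \<noteq> y"
    then have "min x y < max x y" by auto
    then obtain q where "min x y < real_of_rat q" "real_of_rat q < max x y"
      using of_rat_dense by blast
    then have "cut x q \<noteq> cut y q"
      by (auto simp: cut_def min_def max_def split: if_splits)
    with eq show False by simp
  qed
  then have "|UNIV :: real set| \<le>o |Func (UNIV :: rat set) (UNIV :: bool set)|"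
    by (intro card_of_ordLeqI) (auto simp: Func_def)
  moreover have "|UNIV :: bool set| \<le>o ctwo ^c natLeq"
    by (rule finite_le_continuum) simp
  ultimately show ?thesis
    by (rule ordLeq_transitive[OF _ card_Func_countable_le_continuum])
qed

lemma dens_le_card: "dens S \<le>o |S|"
proof (rule dens_attained[of S])
  fix D
  assume "dens S = |D|" and min: "\<And>D'. dense_subset D' S \<Longrightarrow> |D| \<le>o |D'|"
  have "dense_subset S S"
    by (simp add: dense_subset_def closure_subset)
  from min[OF this] show ?thesis
    by (simp only: \<open>dens S = |D|\<close>)
qed

theorem theorem4p1:
  fixes Y :: "'a::banach set"
  assumes "transitive_space TYPE('a)"
    and "subspace Y"
    and "dens Y \<le>o ctwo ^c natLeq"
  shows "\<exists>Z :: 'a set. subspace Z \<and> closed Z \<and>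
           Y \<subseteq> Z \<and>
           dens Z \<le>o ctwo ^c natLeq \<and>
           (\<forall>x \<in> unit_sphere Z. \<forall>y \<in> unit_sphere Z.
              \<exists>T \<in> {T \<in> isometry_group. T ` Z = Z}. T x = y)"
proof -
  obtain D where D: "dense_subset D Y" "dens Y = |D|"
    by (rule dens_attained)
  have "\<exists>T\<in>isometry_group. T x = y" if "norm x = 1" "norm y = 1" for x y :: 'a
  proof -
    have "{T x | T. T \<in> isometry_group} = {z. norm z = 1}"
      using assms(1) that(1) by (simp add: transitive_space_def unit_sphere_def)
    with that(2) have "y \<in> {T x | T. T \<in> isometry_group}" by simp
    then show ?thesis by blast
  qed
  then have "\<forall>x y :: 'a. \<exists>T. norm x = 1 \<longrightarrow> norm y = 1 \<longrightarrow> T \<in> isometry_group \<and> T x = y"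
    by blast
  then obtain T where T: "\<And>x y :: 'a. norm x = 1 \<Longrightarrow> norm y = 1 \<Longrightarrow>
      T x y \<in> isometry_group \<and> T x y x = y"
    unfolding choice_iff by blast
  \<comment> \<open>To share one arity, the operations with two or three arguments read them off the start of
    a sequence.\<close>
  define combine where "combine r s = s 0 + r *\<^sub>R s 1" for r and s :: "nat \<Rightarrow> 'a"
  define move where "move s = T (s 0) (s 1) (s 2)" for s :: "nat \<Rightarrow> 'a"
  define move_back where "move_back s = inv (T (s 0) (s 1)) (s 2)" for s :: "nat \<Rightarrow> 'a"
  define F where "F = range combine \<union> {move, move_back, lim}"
  have "|range combine| \<le>o ctwo ^c natLeq"
    by (rule ordLeq_transitive[OF card_of_image card_real_le_continuum])
  moreover have "|{move, move_back, lim}| \<le>o ctwo ^c natLeq"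
    by (rule finite_le_continuum) simp
  ultimately have F_small: "|F| \<le>o ctwo ^c natLeq"
    unfolding F_def by (rule Un_le_continuum)
  have D_small: "|D| \<le>o ctwo ^c natLeq"
    using assms(3) D(2) by simp
  obtain Z where DZ: "D \<subseteq> Z" and Z: "\<And>f s. f \<in> F \<Longrightarrow> range s \<subseteq> Z \<Longrightarrow> f s \<in> Z"
    and Z_small: "|Z| \<le>o ctwo ^c natLeq"
    using closure_under_operations_le_continuum[OF D_small F_small] by blast

  have combination: "x + r *\<^sub>R y \<in> Z" if "x \<in> Z" "y \<in> Z" for x y r
    using Z[of "combine r" "\<lambda>n. if n = 0 then x else y"] that
    by (auto simp: F_def combine_def image_subset_iff)
  have T_in: "T x y z \<in> Z" if "x \<in> Z" "y \<in> Z" "z \<in> Z" for x y z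
    using Z[of move "\<lambda>n. if n = 0 then x else if n = 1 then y else z"] that
    by (auto simp: F_def move_def image_subset_iff)
  have T_inv_in: "inv (T x y) z \<in> Z" if "x \<in> Z" "y \<in> Z" "z \<in> Z" for x y z
    using Z[of move_back "\<lambda>n. if n = 0 then x else if n = 1 then y else z"] that
    by (auto simp: F_def move_back_def image_subset_iff)
  have limit: "l \<in> Z" if "\<And>n. s n \<in> Z" "s \<longlonglongrightarrow> l" for s l
    using Z[of lim s] that limI[OF that(2)] by (auto simp: F_def)

  have closed: "closed Z"
    using limit by (auto simp: closed_sequential_limits)
  \<comment> \<open>The set \<open>D\<close> of generators need not contain 0, but it is nonempty because \<open>Y\<close> is.\<close>
  have "D \<noteq> {}"
    using D(1) subspace_0[OF assms(2)] by (auto simp: dense_subset_def)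
  then obtain d where "d \<in> Z" using DZ by blast
  then have zero: "0 \<in> Z"
    using combination[of d d "-1"] by simp
  have subspace: "subspace Z"
    using zero combination[of _ _ 1] combination[OF zero] by (auto simp: subspace_def)
  have "Y \<subseteq> Z"
    using D(1) closure_minimal[OF DZ closed] by (auto simp: dense_subset_def)
  moreover have "dens Z \<le>o ctwo ^c natLeq"
    by (rule ordLeq_transitive[OF dens_le_card Z_small])
  moreover have "\<exists>T \<in> {T \<in> isometry_group. T ` Z = Z}. T x = y"
    if "x \<in> unit_sphere Z" "y \<in> unit_sphere Z" for x y
  proof -
    have xy: "x \<in> Z" "y \<in> Z" "norm x = 1" "norm y = 1"
      using that by (auto simp: unit_sphere_def)
    have iso: "T x y \<in> isometry_group" "T x y x = y"
      using T xy by auto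
    then have "surj (T x y)"
      by (simp add: isometry_group_def)
    then have "z = T x y (inv (T x y) z)" for z
      by (simp add: surj_f_inv_f)
    then have "T x y ` Z = Z"
      using T_in T_inv_in xy by blast
    with iso show ?thesis by blast
  qed
  ultimately show ?thesis
    using closed subspace by blast
qed

end
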